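(* Let $k$ be a field and let $R$ be an ideal of a finite poset $S$. For an $R$-space $\mathbf U=(U,U(r))_{r\in R}$ and an $S$-space $\mathbf V=(V,V(s))_{s\in S}$, let $f:\mathbf U\to\mathrm{res}^S_R\mathbf V$ be a morphism in $R\text{-sp}$ given by a $k$-linear map $f:U\to V$. Set $\mathbf U_f=(X,X(s))_{s\in S}$ where $X=U$, $X(r)=U(r)$ for all $r\in R$, and $X(t)=f^{-1}(V(t))$ for all $t\in S\setminus R$. (a) $\mathbf U_f$ is an $S$-space, and the linear map $f:U\to V$ gives a morphism $\hat f:\mathbf U_f\to\mathbf V$ in $S\text{-sp}$ satisfying $f=\mathrm{res}^S_R\hat f$. Moreover, $f$ is a proper morphism (respectively, an isomorphism) if and only if so is $\hat f$. (b) Let $\mathbf Y=(Y,Y(r))_{r\in R}\in R\text{-sp}$, $\mathbf Z=(Z,Z(s))_{s\in S}\in S\text{-sp}$, and let $g:\mathbf Y\to\mathrm{res}^S_R\mathbf Z$ and $\alpha:\mathbf U\to\mathbf Y$ in $R\text{-sp}$ and $\beta:\mathbf V\to\mathbf Z$ in $S\text{-sp}$ be morphisms, given by $k$-linear maps denoted by the same letters, such that $(\mathrm{res}^S_R\beta)f=g\alpha$. Then the linear map $\alpha:U\to Y$ gives a morphism $\alpha':\mathbf U_f\to\mathbf Y_g$ in $S\text{-sp}$ satisfying $\alpha=\mathrm{res}^S_R\alpha'$ and $\beta\hat f=\hat g\alpha'$. In particular, the functor $\mathrm{res}^S_R$ is right quasi full. (c) In the setting of (b), suppose $\beta$ is an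 isomorphism. Then $\mathbf U_f=\mathbf U_\alpha$ and $\alpha'=\hat\alpha:\mathbf U_\alpha\to\mathbf Y_g$, where $\mathbf U_\alpha$ and $\hat\alpha$ are obtained by applying the construction to $\alpha:\mathbf U\to\mathbf Y=\mathrm{res}^S_R\mathbf Y_g$. (d) The morphism $f$ is right minimal if and only if $\hat f$ is right minimal. (e) If $F$ is a filter of $S$ and $\mathbf V\cong\mathrm{ind}^S_F\mathbf W$ for some $\mathbf W\in F\text{-sp}$, then the $S$-space $\mathbf U_f=(X,X(s))_{s\in S}$ satisfies $X(s)\subseteq\mathrm{Ker} f$ for all $s\in R\setminus F$, and $X(s)=\mathrm{Ker} f$ for all $s\in S\setminus[R\cup F]$.
   Context: For a finite poset $S$, an $S$-space is a family $\mathbf V=(V,V(s))_{s\in S}$ where $V$ is a finite dimensional $k$-vector space (the ambient space), each $V(s)$ is a subspace of $V$, and $s\le t$ implies $V(s)\subseteq V(t)$. A morphism $f:(U,U(s))\to(V,V(s))$ is a $k$-linear map $f:U\to V$ with $f(U(s))\subseteq V(s)$ for all $s$. The category of $S$-spaces is $S\text{-sp}$. A morphism $f:\mathbf U\to\mathbf V$ is proper if $f(U(s))=V(s)\cap f(U)$ for all $s\in S$; it is right minimal if every morphism $g:\mathbf U\to\mathbf U$ with $f=fg$ is an automorphism. A subset $F\subseteq S$ is a filter if $t\in F$, $t\le s$ imply $s\in F$; $I\subseteq S$ is an ideal if $t\in I$, $s\le t$ imply $s\in I$. Subsets of a poset carry the induced order. For $R\subseteq S$: $\mathrm{res}^S_R:S\text{-sp}\to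 R\text{-sp}$ sends $(V,V(s))_{s\in S}$ to $(V,V(r))_{r\in R}$; $\mathrm{ind}^S_R:R\text{-sp}\to S\text{-sp}$ sends $(V,V(r))_{r\in R}$ to $(V,X(s))_{s\in S}$ with $X(s)=\sum_{r\in R,\,r\le s}V(r)$ (equal to $0$ if there is no such $r$). On morphisms both keep the underlying linear map. A functor $F:\mathfrak A\to\mathfrak B$ is right quasi full if for all objects $u,v,y,z$ of $\mathfrak A$, every morphism $\beta:v\to z$ in $\mathfrak A$, and all morphisms $f:Fu\to Fv$, $g:Fy\to Fz$, $\alpha:Fu\to Fy$ in $\mathfrak B$ with $(F\beta)f=g\alpha$, there exist morphisms $f':u'\to v$, $g':y'\to z$, $\alpha':u'\to y'$ in $\mathfrak A$ with $f=Ff'$, $g=Fg'$, $\alpha=F\alpha'$ and $\beta f'=g'\alpha'$ (in particular $Fu'=Fu$, $Fy'=Fy$). *)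

theory Defs
  imports Jordan_Normal_Form.Missing_VectorSpace
begin

section \<open>Spaces over a poset\<close>

text \<open>
  A finite poset is a finite subset \<open>S\<close> of a type of class \<open>order\<close>; subsets of \<open>S\<close> then carry
  the induced order without further ado. The ground field \<open>K\<close> is a ring record satisfying
  \<^locale>\<open>field\<close>, and ambient spaces are arbitrary vector spaces in the sense of
  \<^locale>\<open>vectorspace\<close>, that is, carrier sets with operations.
\<close>

definition order_ideal :: "'s::order set \<Rightarrow> 's set \<Rightarrow> bool" where
  "order_ideal S I \<longleftrightarrow> I \<subseteq> S \<and> (\<forall>t\<in>I. \<forall>s\<in>S. s \<le> t \<longrightarrow> s \<in> I)"

definition order_filter :: "'s::order set \<Rightarrow> 's set \<Rightarrow> bool" where
  "order_filter S F \<longleftrightarrow> F \<subseteq> S \<and> (\<forall>t\<in>F. \<forall>s\<in>S. t \<le> s \<longrightarrow> s \<in> F)"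

record ('k, 'v, 's) sspace =
  amb :: "('k, 'v) module"
  fam :: "'s \<Rightarrow> 'v set"

text \<open>
  Families indexed by \<open>S\<close> and linear maps are required to be extensional (\<^const>\<open>undefined\<close>
  outside the index set, respectively outside the carrier of the source), so that equality in HOL
  is equality of \<open>S\<close>-spaces and of morphisms.
\<close>

definition S_space :: "('k, 'm) ring_scheme \<Rightarrow> 's::order set \<Rightarrow> ('k, 'v, 's) sspace \<Rightarrow> bool" where
  "S_space K S V \<longleftrightarrow>
     vectorspace K (amb V) \<and> vectorspace.fin_dim K (amb V) \<and>
     (\<forall>s\<in>S. subspace K (fam V s) (amb V)) \<and>
     (\<forall>s\<in>S. \<forall>t\<in>S. s \<le> t \<longrightarrow> fam V s \<subseteq> fam V t) \<and>
     fam V \<in> extensional S"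

text \<open>The source and the target of a morphism may have vectors of different types.\<close>

record ('k, 'u, 'v, 's) smor =
  src :: "('k, 'u, 's) sspace"
  tgt :: "('k, 'v, 's) sspace"
  lin :: "'u \<Rightarrow> 'v"

definition S_mor ::
  "('k, 'm) ring_scheme \<Rightarrow> 's::order set \<Rightarrow> ('k, 'u, 'v, 's) smor \<Rightarrow> bool" where
  "S_mor K S f \<longleftrightarrow>
     S_space K S (src f) \<and> S_space K S (tgt f) \<and>
     linear_map K (amb (src f)) (amb (tgt f)) (lin f) \<and>
     lin f \<in> extensional (carrier (amb (src f))) \<and>
     (\<forall>s\<in>S. lin f ` fam (src f) s \<subseteq> fam (tgt f) s)"

definition S_hom ::
  "('k, 'm) ring_scheme \<Rightarrow> 's::order set \<Rightarrow> ('k, 'u, 's) sspace \<Rightarrow> ('k, 'v, 's) sspace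
     \<Rightarrow> ('k, 'u, 'v, 's) smor set" where
  "S_hom K S U V = {f. S_mor K S f \<and> src f = U \<and> tgt f = V}"

definition S_id :: "('k, 'v, 's) sspace \<Rightarrow> ('k, 'v, 'v, 's) smor" where
  "S_id V = \<lparr>src = V, tgt = V, lin = (\<lambda>x\<in>carrier (amb V). x)\<rparr>"

definition S_comp ::
  "('k, 'v, 'w, 's) smor \<Rightarrow> ('k, 'u, 'v, 's) smor \<Rightarrow> ('k, 'u, 'w, 's) smor" where
  "S_comp g f =
     \<lparr>src = src f, tgt = tgt g, lin = compose (carrier (amb (src f))) (lin g) (lin f)\<rparr>"

definition S_iso ::
  "('k, 'm) ring_scheme \<Rightarrow> 's::order set \<Rightarrow> ('k, 'u, 'v, 's) smor \<Rightarrow> bool" where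
  "S_iso K S f \<longleftrightarrow> S_mor K S f \<and>
     (\<exists>g \<in> S_hom K S (tgt f) (src f).
        S_comp g f = S_id (src f) \<and> S_comp f g = S_id (tgt f))"

definition S_isomorphic ::
  "('k, 'm) ring_scheme \<Rightarrow> 's::order set \<Rightarrow> ('k, 'u, 's) sspace \<Rightarrow> ('k, 'v, 's) sspace \<Rightarrow> bool"
where
  "S_isomorphic K S U V \<longleftrightarrow> (\<exists>f \<in> S_hom K S U V. S_iso K S f)"

definition proper_mor ::
  "('k, 'm) ring_scheme \<Rightarrow> 's::order set \<Rightarrow> ('k, 'u, 'v, 's) smor \<Rightarrow> bool" where
  "proper_mor K S f \<longleftrightarrow> S_mor K S f \<and>
     (\<forall>s\<in>S. lin f ` fam (src f) s = fam (tgt f) s \<inter> lin f ` carrier (amb (src f)))"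

definition right_minimal ::
  "('k, 'm) ring_scheme \<Rightarrow> 's::order set \<Rightarrow> ('k, 'u, 'v, 's) smor \<Rightarrow> bool" where
  "right_minimal K S f \<longleftrightarrow> S_mor K S f \<and>
     (\<forall>g \<in> S_hom K S (src f) (src f). f = S_comp f g \<longrightarrow> S_iso K S g)"

definition Ker :: "('k, 'u, 'v, 's) smor \<Rightarrow> 'u set" where
  "Ker f = {x \<in> carrier (amb (src f)). lin f x = \<zero>\<^bsub>amb (tgt f)\<^esub>}"


section \<open>Restriction and induction\<close>

definition res :: "'s set \<Rightarrow> ('k, 'v, 's) sspace \<Rightarrow> ('k, 'v, 's) sspace" where
  "res R V = \<lparr>amb = amb V, fam = restrict (fam V) R\<rparr>"

definition res_mor :: "'s set \<Rightarrow> ('k, 'u, 'v, 's) smor \<Rightarrow> ('k, 'u, 'v, 's) smor" where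
  "res_mor R f = \<lparr>src = res R (src f), tgt = res R (tgt f), lin = lin f\<rparr>"

text \<open>The sum of a finite family of subspaces, which is the zero subspace for the empty family.\<close>

definition sum_subspaces :: "('k, 'v) module \<Rightarrow> 's set \<Rightarrow> ('s \<Rightarrow> 'v set) \<Rightarrow> 'v set" where
  "sum_subspaces M J W = {\<Oplus>\<^bsub>M\<^esub>r\<in>J. x r | x. x \<in> (\<Pi> r\<in>J. W r)}"

definition ind :: "'s::order set \<Rightarrow> 's set \<Rightarrow> ('k, 'v, 's) sspace \<Rightarrow> ('k, 'v, 's) sspace" where
  "ind S R V =
     \<lparr>amb = amb V, fam = (\<lambda>s\<in>S. sum_subspaces (amb V) {r\<in>R. r \<le> s} (fam V))\<rparr>"


section \<open>The spaces \<open>U\<^sub>f\<close> and the morphisms from them\<close>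

text \<open>
  \<open>ext_space S R f V\<close> is \<open>U\<^sub>f\<close> for \<open>f : U \<rightarrow> res R V\<close>. The \<open>S\<close>-space \<open>V\<close> is an argument of its
  own because the target of \<open>f\<close> has forgotten the subspaces indexed by \<open>S - R\<close>.
\<close>

definition ext_space ::
  "'s set \<Rightarrow> 's set \<Rightarrow> ('k, 'u, 'v, 's) smor \<Rightarrow> ('k, 'v, 's) sspace \<Rightarrow> ('k, 'u, 's) sspace" where
  "ext_space S R f V =
     \<lparr>amb = amb (src f),
      fam = (\<lambda>s\<in>S. if s \<in> R then fam (src f) s
                    else {x \<in> carrier (amb (src f)). lin f x \<in> fam V s})\<rparr>"

definition hat ::
  "'s set \<Rightarrow> 's set \<Rightarrow> ('k, 'u, 'v, 's) smor \<Rightarrow> ('k, 'v, 's) sspace \<Rightarrow> ('k, 'u, 'v, 's) smor" where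
  "hat S R f V = \<lparr>src = ext_space S R f V, tgt = V, lin = lin f\<rparr>"


section \<open>Categories and right quasi full functors\<close>

record ('o, 'a) category =
  Obj :: "'o set"
  Arr :: "'a set"
  Dom :: "'a \<Rightarrow> 'o"
  Cod :: "'a \<Rightarrow> 'o"
  Idt :: "'o \<Rightarrow> 'a"
  Cmp :: "'a \<Rightarrow> 'a \<Rightarrow> 'a"

definition Hom :: "('o, 'a) category \<Rightarrow> 'o \<Rightarrow> 'o \<Rightarrow> 'a set" where
  "Hom A x y = {f \<in> Arr A. Dom A f = x \<and> Cod A f = y}"

definition is_category :: "('o, 'a) category \<Rightarrow> bool" where
  "is_category A \<longleftrightarrow>
     (\<forall>f\<in>Arr A. Dom A f \<in> Obj A \<and> Cod A f \<in> Obj A) \<and>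
     (\<forall>x\<in>Obj A. Idt A x \<in> Hom A x x) \<and>
     (\<forall>f\<in>Arr A. \<forall>g\<in>Arr A. Cod A f = Dom A g \<longrightarrow> Cmp A g f \<in> Hom A (Dom A f) (Cod A g)) \<and>
     (\<forall>f\<in>Arr A. Cmp A f (Idt A (Dom A f)) = f \<and> Cmp A (Idt A (Cod A f)) f = f) \<and>
     (\<forall>f\<in>Arr A. \<forall>g\<in>Arr A. \<forall>h\<in>Arr A. Cod A f = Dom A g \<and> Cod A g = Dom A h \<longrightarrow>
        Cmp A h (Cmp A g f) = Cmp A (Cmp A h g) f)"

record ('o1, 'a1, 'o2, 'a2) funct =
  on_obj :: "'o1 \<Rightarrow> 'o2"
  on_arr :: "'a1 \<Rightarrow> 'a2"

definition is_functor ::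
  "('o1, 'a1) category \<Rightarrow> ('o2, 'a2) category \<Rightarrow> ('o1, 'a1, 'o2, 'a2) funct \<Rightarrow> bool" where
  "is_functor A B F \<longleftrightarrow> is_category A \<and> is_category B \<and>
     (\<forall>x\<in>Obj A. on_obj F x \<in> Obj B) \<and>
     (\<forall>f\<in>Arr A. on_arr F f \<in> Hom B (on_obj F (Dom A f)) (on_obj F (Cod A f))) \<and>
     (\<forall>x\<in>Obj A. on_arr F (Idt A x) = Idt B (on_obj F x)) \<and>
     (\<forall>f\<in>Arr A. \<forall>g\<in>Arr A. Cod A f = Dom A g \<longrightarrow>
        on_arr F (Cmp A g f) = Cmp B (on_arr F g) (on_arr F f))"

text \<open>
  The equations \<open>F u' = F u\<close> and \<open>F y' = F y\<close> are consequences, as arrows determine their domains.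
\<close>

definition right_quasi_full ::
  "('o1, 'a1) category \<Rightarrow> ('o2, 'a2) category \<Rightarrow> ('o1, 'a1, 'o2, 'a2) funct \<Rightarrow> bool" where
  "right_quasi_full A B F \<longleftrightarrow> is_functor A B F \<and>
     (\<forall>u\<in>Obj A. \<forall>v\<in>Obj A. \<forall>y\<in>Obj A. \<forall>z\<in>Obj A. \<forall>\<beta>\<in>Hom A v z.
      \<forall>f\<in>Hom B (on_obj F u) (on_obj F v).
      \<forall>g\<in>Hom B (on_obj F y) (on_obj F z).
      \<forall>\<alpha>\<in>Hom B (on_obj F u) (on_obj F y).
        Cmp B (on_arr F \<beta>) f = Cmp B g \<alpha> \<longrightarrow>
        (\<exists>u'\<in>Obj A. \<exists>y'\<in>Obj A. \<exists>f'\<in>Hom A u' v. \<exists>g'\<in>Hom A y' z. \<exists>\<alpha>'\<in>Hom A u' y'.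
           f = on_arr F f' \<and> g = on_arr F g' \<and> \<alpha> = on_arr F \<alpha>' \<and>
           Cmp A \<beta> f' = Cmp A g' \<alpha>'))"

text \<open>
  The category of all \<open>S\<close>-spaces over \<open>K\<close> whose ambient space has a carrier of elements of the
  type \<open>'v\<close>.
\<close>

definition S_sp ::
  "('k, 'm) ring_scheme \<Rightarrow> 's::order set \<Rightarrow> (('k, 'v, 's) sspace, ('k, 'v, 'v, 's) smor) category"
where
  "S_sp K S =
     \<lparr>Obj = {V. S_space K S V}, Arr = {f. S_mor K S f}, Dom = src, Cod = tgt,
      Idt = S_id, Cmp = S_comp\<rparr>"

definition res_functor ::
  "'s set \<Rightarrow> (('k, 'v, 's) sspace, ('k, 'v, 'v, 's) smor,
               ('k, 'v, 's) sspace, ('k, 'v, 'v, 's) smor) funct" where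
  "res_functor R = \<lparr>on_obj = res R, on_arr = res_mor R\<rparr>"

end

theory Submission
  imports Defs
begin

section \<open>Linear maps and subspaces\<close>

text \<open>For t outside R, the preimage f^{-1}(V(t)) is the largest subspace X(t) for which f can
  still be a morphism into V. Membership of x in X(t) is therefore decided by f x alone, and every
  condition indexed by S - R can be read off in V.

  Because R is an ideal, no element of S - R lies below an element of R. Monotonicity of X thus only
  needs f(X(s)) <= V(s) <= V(t) for t outside R (\<open>lin_fam_ext\<close>,
  \<open>S_space_ext\<close>). Properness outside R is the identity f(f^{-1}(V(t))) = V(t) Int f(U).
  An isomorphism is a bijective morphism that reflects membership in every subspace
  (\<open>S_iso_iff\<close>), and a preimage reflects by definition.

  For a square \<beta> f = g \<alpha>, f x in V(t) implies g(\<alpha> x) in Z(t), so \<alpha>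
  respects the new subspaces (\<open>lift_hom\<close>); when \<beta> is an isomorphism the
  implication reverses and U_f = U_\<alpha> (\<open>ext_eq_ext_\<alpha>\<close>). Right minimality
  is the case g = f, \<beta> = id: if f = f h, then x and h x have the same image under f, so h
  satisfies the conditions outside R for free (\<open>endo_iso_iff\<close>). Finally, an induced
  space vanishes outside the filter, and the preimage of 0 is the kernel.\<close>

lemma linear_map_iff:
  "linear_map K V W T \<longleftrightarrow> vectorspace K V \<and> vectorspace K W \<and> T \<in> module_hom K V W"
  unfolding linear_map_def mod_hom_def mod_hom_axioms_def vectorspace_def by blast

text \<open>By bijectivity, a vector is the inverse image of y as soon as T sends it to y, so both
  linearity identities are checked after applying T. The restriction makes the inverse extensional,
  as morphisms must be.\<close>

lemma linear_map_inv_into: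
  assumes T: "linear_map K V W T" and bij: "bij_betw T (carrier V) (carrier W)"
  shows "linear_map K W V (restrict (inv_into (carrier V) T) (carrier W))"
proof -
  interpret T: linear_map K V W T by (rule T)
  let ?G = "inv_into (carrier V) T"
  have cl: "?G y \<in> carrier V" if "y \<in> carrier W" for y
    using bij that by (metis bij_betw_imp_surj_on inv_into_into)
  have r: "T (?G y) = y" if "y \<in> carrier W" for y
    using bij that by (metis bij_betw_inv_into_right)
  have eqI: "?G y = x" if "x \<in> carrier V" "T x = y" for x y
    using bij that by (metis bij_betw_inv_into_left)
  have "?G (y \<oplus>\<^bsub>W\<^esub> z) = ?G y \<oplus>\<^bsub>V\<^esub> ?G z" if "y \<in> carrier W" "z \<in> carrier W" for y z
    using that by (intro eqI) (simp_all add: cl r)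
  moreover have "?G (c \<odot>\<^bsub>W\<^esub> y) = c \<odot>\<^bsub>V\<^esub> ?G y" if "c \<in> carrier K" "y \<in> carrier W" for c y
    using that by (intro eqI) (simp_all add: cl r)
  ultimately have "restrict ?G (carrier W) \<in> module_hom K W V"
    by (auto simp: module_hom_def cl)
  with T show ?thesis by (simp add: linear_map_iff)
qed

lemma linear_map_compose:
  assumes T: "linear_map K U V T" and T': "linear_map K V W T'"
  shows "linear_map K U W (compose (carrier U) T' T)"
proof -
  interpret T: linear_map K U V T by (rule T)
  interpret T': linear_map K V W T' by (rule T')
  have "compose (carrier U) T' T \<in> module_hom K U W"
    by (auto simp: module_hom_def compose_def)
  with T T' show ?thesis by (simp add: linear_map_iff)
qed

lemma linear_map_restrict_id:
  assumes "vectorspace K V"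
  shows "linear_map K V V (\<lambda>x\<in>carrier V. x)"
proof -
  interpret vectorspace K V by (rule assms)
  show ?thesis using assms by (auto simp: linear_map_iff module_hom_def)
qed

text \<open>Supplies the subspace condition on f^{-1}(V(t)) for t outside R.\<close>

lemma subspace_preimage:
  assumes T: "linear_map K V W T" and N: "subspace K N W"
  shows "subspace K {x \<in> carrier V. T x \<in> N} V"
proof -
  interpret T: linear_map K V W T by (rule T)
  interpret N: submodule K N W using N by (simp add: subspace_def)
  have "submodule K {x \<in> carrier V. T x \<in> N} V"
    by unfold_locales auto
  then show ?thesis by (simp add: subspace_def T.V.vectorspace_axioms)
qed

lemma subspace_carrier: "subspace K N V \<Longrightarrow> N \<subseteq> carrier V"
  by (simp add: subspace_def submodule_def)

lemma subspace_zero: "subspace K N V \<Longrightarrow> \<zero>\<^bsub>V\<^esub> \<in> N"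
  by (simp add: subspace_def submodule_def)


section \<open>Spaces over a poset and their morphisms\<close>

lemma S_space_fam_carrier: "S_space K S V \<Longrightarrow> s \<in> S \<Longrightarrow> fam V s \<subseteq> carrier (amb V)"
  unfolding S_space_def by (meson subspace_carrier)

lemma S_mor_closed: "S_mor K S f \<Longrightarrow> x \<in> carrier (amb (src f)) \<Longrightarrow> lin f x \<in> carrier (amb (tgt f))"
  by (auto simp: S_mor_def linear_map_iff module_hom_def)

lemma S_mor_fam: "S_mor K S f \<Longrightarrow> s \<in> S \<Longrightarrow> x \<in> fam (src f) s \<Longrightarrow> lin f x \<in> fam (tgt f) s"
  by (auto simp: S_mor_def)

lemma S_mor_id: "S_space K S V \<Longrightarrow> S_mor K S (S_id V)"
  using S_space_fam_carrier[of K S V]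
  by (auto simp: S_mor_def S_id_def linear_map_restrict_id S_space_def)

lemma S_mor_comp:
  assumes f: "S_mor K S f" and g: "S_mor K S g" and e: "tgt f = src g"
  shows "S_mor K S (S_comp g f)"
proof -
  have "linear_map K (amb (src f)) (amb (tgt g)) (compose (carrier (amb (src f))) (lin g) (lin f))"
    using f g e by (intro linear_map_compose) (auto simp: S_mor_def)
  moreover have "lin g (lin f x) \<in> fam (tgt g) s" if "s \<in> S" "x \<in> fam (src f) s" for s x
    using S_mor_fam[OF g that(1)] S_mor_fam[OF f that] e by simp
  moreover have "fam (src f) s \<subseteq> carrier (amb (src f))" if "s \<in> S" for s
    using f that S_space_fam_carrier unfolding S_mor_def by metis
  ultimately show ?thesis
    using f g by (auto simp: S_mor_def S_comp_def compose_def)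
qed

section \<open>Pointwise criteria for equality and isomorphism of morphisms\<close>

lemma S_comp_eq_iff:
  assumes "tgt g = tgt g'" and "src f = src f'"
  shows "S_comp g f = S_comp g' f' \<longleftrightarrow>
    (\<forall>x\<in>carrier (amb (src f)). lin g (lin f x) = lin g' (lin f' x))"
  using assms by (auto simp: S_comp_def compose_def fun_eq_iff restrict_def)

text \<open>Both sides are \<open>undefined\<close> outside the source carrier, \<open>h\<close> by
  extensionality and the composite by \<open>compose\<close>, so equality of records reduces to
  equality of values on the carrier.\<close>

lemma eq_S_comp_iff:
  assumes "S_mor K S h" "src h = src f" "tgt h = tgt g"
  shows "h = S_comp g f \<longleftrightarrow> (\<forall>x\<in>carrier (amb (src f)). lin h x = lin g (lin f x))"
proof -
  have "lin h \<in> extensional (carrier (amb (src f)))" using assms by (simp add: S_mor_def)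
  then show ?thesis using assms
    by (cases h) (auto simp: S_comp_def compose_def fun_eq_iff restrict_def extensional_def)
qed

text \<open>The inverse of a bijective linear map is linear, and the inverse preserves the subspaces
  exactly when f reflects membership in them. This turns the existence of an inverse morphism into a
  condition that can be compared for R and for S.\<close>

lemma S_iso_iff:
  "S_iso K S f \<longleftrightarrow> S_mor K S f \<and>
     bij_betw (lin f) (carrier (amb (src f))) (carrier (amb (tgt f))) \<and>
     (\<forall>s\<in>S. \<forall>x\<in>carrier (amb (src f)). lin f x \<in> fam (tgt f) s \<longrightarrow> x \<in> fam (src f) s)"
    (is "?L \<longleftrightarrow> ?R")
proof
  assume L: ?L
  then obtain g where f: "S_mor K S f" and g: "S_mor K S g" "src g = tgt f" "tgt g = src f"
    and gf: "S_comp g f = S_id (src f)" and fg: "S_comp f g = S_id (tgt f)"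
    by (auto simp: S_iso_def S_hom_def)
  have gf': "lin g (lin f x) = x" if "x \<in> carrier (amb (src f))" for x
    using gf that by (auto simp: S_comp_def S_id_def compose_def fun_eq_iff restrict_def) meson
  have fg': "lin f (lin g x) = x" if "x \<in> carrier (amb (tgt f))" for x
    using fg that g by (auto simp: S_comp_def S_id_def compose_def fun_eq_iff restrict_def) meson
  have "bij_betw (lin f) (carrier (amb (src f))) (carrier (amb (tgt f)))"
    using S_mor_closed[OF f] S_mor_closed[OF g(1)] g
    by (intro bij_betw_byWitness[where f' = "lin g"]) (auto simp: gf' fg')
  moreover have "x \<in> fam (src f) s"
    if "s \<in> S" "x \<in> carrier (amb (src f))" "lin f x \<in> fam (tgt f) s" for s x
    using S_mor_fam[OF g(1) that(1)] that g gf' by metis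
  ultimately show ?R using f by blast
next
  assume R: ?R
  let ?U = "src f" and ?V = "tgt f"
  let ?G = "restrict (inv_into (carrier (amb ?U)) (lin f)) (carrier (amb ?V))"
  let ?g = "\<lparr>src = ?V, tgt = ?U, lin = ?G\<rparr>"
  have f: "S_mor K S f" and bij: "bij_betw (lin f) (carrier (amb ?U)) (carrier (amb ?V))"
    using R by auto
  have gf: "?G (lin f x) = x" if "x \<in> carrier (amb ?U)" for x
    using bij that S_mor_closed[OF f] by (simp add: bij_betw_inv_into_left)
  have fg: "lin f (?G y) = y" if "y \<in> carrier (amb ?V)" for y
    using bij that by (simp add: bij_betw_inv_into_right)
  have cl: "?G y \<in> carrier (amb ?U)" if "y \<in> carrier (amb ?V)" for y
    using bij that by (metis bij_betw_imp_surj_on inv_into_into restrict_apply')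
  have "?G y \<in> fam ?U s" if "s \<in> S" "y \<in> fam ?V s" for s y
  proof -
    have y: "y \<in> carrier (amb ?V)" using f that by (auto simp: S_mor_def dest: S_space_fam_carrier)
    \<comment> \<open>Reflection is applied to the vector \<open>?G y\<close>, whose image under f
      is y.\<close>
    then show ?thesis using R that cl[OF y] fg[OF y] by metis
  qed
  then have "S_mor K S ?g"
    using f bij linear_map_inv_into[of K "amb ?U" "amb ?V" "lin f"] unfolding S_mor_def
    by (simp add: image_subset_iff del: restrict_apply)
  moreover have "S_comp ?g f = S_id ?U"
    using gf by (auto simp: S_comp_def S_id_def compose_def simp del: restrict_apply intro!: restrict_ext)
  moreover have "S_comp f ?g = S_id ?V"
    using fg by (auto simp: S_comp_def S_id_def compose_def simp del: restrict_apply intro!: restrict_ext)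
  ultimately show ?L using f unfolding S_iso_def S_hom_def by force
qed

section \<open>Restriction as a functor, and induction from a filter\<close>

lemma S_space_res: "R \<subseteq> S \<Longrightarrow> S_space K S V \<Longrightarrow> S_space K R (res R V)"
  unfolding S_space_def res_def by (auto simp: subset_iff) metis

lemma S_mor_res: "R \<subseteq> S \<Longrightarrow> S_mor K S f \<Longrightarrow> S_mor K R (res_mor R f)"
  by (auto simp: S_mor_def res_mor_def S_space_res) (auto simp: res_def)

lemma S_comp_id:
  assumes "S_mor K S f"
  shows "S_comp f (S_id (src f)) = f" and "S_comp (S_id (tgt f)) f = f"
proof -
  have "f = S_comp f (S_id (src f))"
    using assms by (subst eq_S_comp_iff[of K S]) (auto simp: S_id_def)
  then show "S_comp f (S_id (src f)) = f" ..
  have "f = S_comp (S_id (tgt f)) f"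
    using assms S_mor_closed[OF assms] by (subst eq_S_comp_iff[of K S]) (auto simp: S_id_def)
  then show "S_comp (S_id (tgt f)) f = f" ..
qed

lemma S_comp_assoc:
  assumes "S_mor K S f" and "tgt f = src g"
  shows "S_comp h (S_comp g f) = S_comp (S_comp h g) f"
  using S_mor_closed[OF assms(1)] assms(2) by (auto simp: S_comp_def compose_def intro!: restrict_ext)

text \<open>Right quasi fullness includes functoriality, which in turn includes the category axioms
  for both source and target.\<close>

lemma is_category_S_sp: "is_category (S_sp K S)"
  unfolding is_category_def Hom_def S_sp_def
  by (auto simp: S_mor_id S_mor_comp S_comp_id S_comp_assoc)
     (auto simp: S_id_def S_comp_def S_mor_def)

lemma is_functor_res:
  assumes "R \<subseteq> S"
  shows "is_functor (S_sp K S) (S_sp K R) (res_functor R)"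
  unfolding is_functor_def
  using assms is_category_S_sp[of K S] is_category_S_sp[of K R]
  by (auto simp: S_sp_def res_functor_def Hom_def S_space_res S_mor_res)
     (auto simp: res_mor_def res_def S_id_def S_comp_def)

text \<open>An r in F with r <= s would force s into the filter, so the sum defining the value at s
  has empty index set and is the zero subspace.\<close>

lemma ind_outside_filter:
  assumes "vectorspace K (amb W)" and "order_filter S F" and "s \<in> S - F"
  shows "fam (ind S F W) s = {\<zero>\<^bsub>amb W\<^esub>}"
proof -
  interpret vectorspace K "amb W" by (rule assms(1))
  have e: "{r \<in> F. r \<le> s} = {}" using assms by (auto simp: order_filter_def)
  have "fam (ind S F W) s = sum_subspaces (amb W) {r \<in> F. r \<le> s} (fam W)"
    using assms(3) by (simp add: ind_def)
  then show ?thesis by (simp only: e) (simp add: sum_subspaces_def)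
qed


section \<open>The spaces \<open>U\<^sub>f\<close>\<close>

text \<open>The R-space U of the theorem is \<open>src f\<close>, so it is not a parameter of its
  own.\<close>

locale res_morphism =
  fixes K :: "('k, 'm) ring_scheme" and S R :: "'s::order set"
    and f :: "('k, 'u, 'v, 's) smor" and V :: "('k, 'v, 's) sspace"
  assumes ideal: "order_ideal S R"
    and S_space: "S_space K S V"
    and mor: "S_mor K R f"
    and tgt: "tgt f = res R V"
begin

lemma R_subset: "R \<subseteq> S"
  using ideal by (simp add: order_ideal_def)

lemma src_space: "S_space K R (src f)"
  using mor by (simp add: S_mor_def)

lemma linear: "linear_map K (amb (src f)) (amb V) (lin f)"
  using mor tgt by (simp add: S_mor_def res_def)

lemma lin_fam: "r \<in> R \<Longrightarrow> x \<in> fam (src f) r \<Longrightarrow> lin f x \<in> fam V r"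
  using S_mor_fam[OF mor] tgt by (simp add: res_def)

lemma amb_ext [simp]: "amb (ext_space S R f V) = amb (src f)"
  by (simp add: ext_space_def)

lemma fam_ext_ideal [simp]: "r \<in> R \<Longrightarrow> fam (ext_space S R f V) r = fam (src f) r"
  using R_subset by (auto simp: ext_space_def)

lemma fam_ext_outside [simp]:
  "t \<in> S \<Longrightarrow> t \<notin> R \<Longrightarrow>
    fam (ext_space S R f V) t = {x \<in> carrier (amb (src f)). lin f x \<in> fam V t}"
  by (simp add: ext_space_def)

lemma fam_ext_carrier: "s \<in> S \<Longrightarrow> fam (ext_space S R f V) s \<subseteq> carrier (amb (src f))"
  using S_space_fam_carrier[OF src_space] by (cases "s \<in> R") auto

text \<open>Inside R this is the morphism property of f, outside it is the definition of the
  preimage. It yields both the monotonicity of X and the morphism from U_f to V.\<close>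

lemma lin_fam_ext:
  assumes "s \<in> S" and "x \<in> fam (ext_space S R f V) s"
  shows "lin f x \<in> fam V s"
  using assms by (cases "s \<in> R") (auto intro: lin_fam)

lemma S_space_ext: "S_space K S (ext_space S R f V)"
proof -
  have "subspace K (fam (ext_space S R f V) s) (amb (src f))" if "s \<in> S" for s
  proof (cases "s \<in> R")
    case True
    then show ?thesis using src_space by (simp add: S_space_def)
  next
    case False
    then show ?thesis
      using that S_space subspace_preimage[OF linear] by (simp add: S_space_def)
  qed
  moreover have "fam (ext_space S R f V) s \<subseteq> fam (ext_space S R f V) t"
    if st: "s \<in> S" "t \<in> S" "s \<le> t" for s t
  proof (cases "t \<in> R")
    case True
    \<comment> \<open>The downward closure of R enters here: it excludes s outside R below t in R,
      where f^{-1}(V(s)) would have to lie in U(t).\<close>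
    then have "s \<in> R" using ideal st by (auto simp: order_ideal_def)
    then show ?thesis using True st src_space by (simp add: S_space_def)
  next
    case False
    have "fam V s \<subseteq> fam V t" using S_space st by (simp add: S_space_def)
    then show ?thesis
      using False st lin_fam_ext[OF st(1)] fam_ext_carrier[OF st(1)] by auto
  qed
  moreover have "fam (ext_space S R f V) \<in> extensional S"
    by (simp add: ext_space_def)
  ultimately show ?thesis
    using src_space unfolding S_space_def by simp
qed

text \<open>The equality is literal and not up to isomorphism, because the family of
  \<open>src f\<close> is extensional on R.\<close>

lemma res_ext: "res R (ext_space S R f V) = src f"
proof -
  have "fam (src f) \<in> extensional R" using src_space by (simp add: S_space_def)
  then have "restrict (fam (ext_space S R f V)) R = fam (src f)"
    by (auto simp: fun_eq_iff restrict_def extensional_def)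
  then show ?thesis by (simp add: res_def)
qed

lemma hat_simps [simp]:
  "src (hat S R f V) = ext_space S R f V" "tgt (hat S R f V) = V" "lin (hat S R f V) = lin f"
  by (simp_all add: hat_def)

lemma S_mor_hat: "S_mor K S (hat S R f V)"
  using mor S_space_ext S_space linear lin_fam_ext by (auto simp: S_mor_def)

lemma res_hat: "res_mor R (hat S R f V) = f"
  by (simp add: res_mor_def res_ext flip: tgt)

lemma tgt_simps [simp]: "amb (tgt f) = amb V" "r \<in> R \<Longrightarrow> fam (tgt f) r = fam V r"
  by (simp_all add: tgt res_def)

text \<open>For s outside R the properness condition reads f(f^{-1}(V(s))) = V(s) Int f(U), which
  holds for every map; only the conditions at R remain.\<close>

lemma proper_hat_iff: "proper_mor K S (hat S R f V) \<longleftrightarrow> proper_mor K R f"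
proof
  assume "proper_mor K S (hat S R f V)"
  then have "\<forall>s\<in>S. lin f ` fam (ext_space S R f V) s = fam V s \<inter> lin f ` carrier (amb (src f))"
    by (simp add: proper_mor_def)
  then have "lin f ` fam (src f) s = fam V s \<inter> lin f ` carrier (amb (src f))" if "s \<in> R" for s
    using that R_subset fam_ext_ideal by (metis subsetD)
  then show "proper_mor K R f" using mor by (simp add: proper_mor_def)
next
  assume p: "proper_mor K R f"
  have "lin f ` fam (ext_space S R f V) s = fam V s \<inter> lin f ` carrier (amb (src f))"
    if "s \<in> S" for s
    using that p by (cases "s \<in> R") (auto simp: proper_mor_def)
  then show "proper_mor K S (hat S R f V)"
    using S_mor_hat by (simp add: proper_mor_def)
qed

text \<open>Both morphisms have the same linear map, hence the same bijectivity condition, and a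
  full preimage reflects membership by definition.\<close>

lemma iso_hat_iff: "S_iso K S (hat S R f V) \<longleftrightarrow> S_iso K R f"
proof -
  have "(\<forall>s\<in>S. \<forall>x\<in>carrier (amb (src f)). lin f x \<in> fam V s \<longrightarrow> x \<in> fam (ext_space S R f V) s) \<longleftrightarrow>
    (\<forall>s\<in>R. \<forall>x\<in>carrier (amb (src f)). lin f x \<in> fam V s \<longrightarrow> x \<in> fam (src f) s)"
    using R_subset fam_ext_outside fam_ext_ideal by blast
  then show ?thesis using mor S_mor_hat by (simp add: S_iso_iff)
qed

lemma fam_ext_eq_Ker:
  assumes "s \<in> S" "s \<notin> R" "fam V s = {\<zero>\<^bsub>amb V\<^esub>}"
  shows "fam (ext_space S R f V) s = Ker f"
  using assms by (auto simp: Ker_def)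

text \<open>This also covers s in R, where X(s) = U(s) is prescribed and may be smaller than the
  kernel.\<close>

lemma fam_ext_subset_Ker:
  assumes "s \<in> S" "fam V s = {\<zero>\<^bsub>amb V\<^esub>}"
  shows "fam (ext_space S R f V) s \<subseteq> Ker f"
  using lin_fam_ext[of s] fam_ext_carrier[of s] assms by (auto simp: Ker_def)

end

section \<open>Commutative squares and the induced morphism from U_f to Y_g\<close>

locale res_square =
  f: res_morphism K S R f V + g: res_morphism K S R g Z
  for K :: "('k, 'm) ring_scheme" and S R :: "'s::order set"
    and f :: "('k, 'u, 'v, 's) smor" and V :: "('k, 'v, 's) sspace"
    and g :: "('k, 'y, 'z, 's) smor" and Z :: "('k, 'z, 's) sspace" +
  fixes \<alpha> :: "('k, 'u, 'y, 's) smor" and \<beta> :: "('k, 'v, 'z, 's) smor"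
  assumes \<alpha>: "\<alpha> \<in> S_hom K R (src f) (src g)"
    and \<beta>: "\<beta> \<in> S_hom K S V Z"
    and square: "S_comp (res_mor R \<beta>) f = S_comp g \<alpha>"
begin

text \<open>The morphism \<alpha>' of part (b).\<close>

definition lift :: "('k, 'u, 'y, 's) smor" where
  "lift = \<lparr>src = ext_space S R f V, tgt = ext_space S R g Z, lin = lin \<alpha>\<rparr>"

lemma \<alpha>_mor: "S_mor K R \<alpha>" and \<alpha>_simps [simp]: "src \<alpha> = src f" "tgt \<alpha> = src g"
  and \<beta>_mor: "S_mor K S \<beta>" and \<beta>_simps [simp]: "src \<beta> = V" "tgt \<beta> = Z"
  using \<alpha> \<beta> by (auto simp: S_hom_def)

lemma commutes: "x \<in> carrier (amb (src f)) \<Longrightarrow> lin \<beta> (lin f x) = lin g (lin \<alpha> x)"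
  using square S_comp_eq_iff[of "res_mor R \<beta>" g f \<alpha>] g.tgt by (simp add: res_mor_def)

lemma \<alpha>_closed: "x \<in> carrier (amb (src f)) \<Longrightarrow> lin \<alpha> x \<in> carrier (amb (src g))"
  using S_mor_closed[OF \<alpha>_mor] by simp

text \<open>Outside R, x in X(s) gives g(\<alpha> x) = \<beta>(f x) in \<beta>(V(s)) <= Z(s), which
  says that \<alpha> x lies in the preimage of Z(s) under g.\<close>

lemma lift_hom: "lift \<in> S_hom K S (ext_space S R f V) (ext_space S R g Z)"
proof -
  have "lin \<alpha> x \<in> fam (ext_space S R g Z) s" if s: "s \<in> S" and x: "x \<in> fam (ext_space S R f V) s" for s x
  proof (cases "s \<in> R")
    case True
    then show ?thesis using x S_mor_fam[OF \<alpha>_mor] by simp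
  next
    case False
    have xc: "x \<in> carrier (amb (src f))" using f.fam_ext_carrier s x by blast
    have "lin \<beta> (lin f x) \<in> fam Z s"
      using S_mor_fam[OF \<beta>_mor s] f.lin_fam_ext[OF s x] by simp
    then show ?thesis using False s xc by (simp add: \<alpha>_closed commutes)
  qed
  then show ?thesis
    using f.S_space_ext g.S_space_ext \<alpha>_mor by (auto simp: S_hom_def S_mor_def lift_def)
qed

lemma res_lift: "res_mor R lift = \<alpha>"
  by (simp add: res_mor_def lift_def f.res_ext g.res_ext flip: \<alpha>_simps)

lemma lift_commutes: "S_comp \<beta> (hat S R f V) = S_comp (hat S R g Z) lift"
  by (simp add: S_comp_eq_iff lift_def commutes)

text \<open>Inside R both families are that of U. Outside R they are the conditions f x in V(s) and
  g(\<alpha> x) = \<beta>(f x) in Z(s), which agree because an isomorphism \<beta> both preserves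
  and reflects membership.\<close>

lemma ext_eq_ext_\<alpha>:
  assumes "S_iso K S \<beta>"
  shows "ext_space S R f V = ext_space S R \<alpha> (ext_space S R g Z)"
proof -
  have "lin f x \<in> fam V s \<longleftrightarrow> lin g (lin \<alpha> x) \<in> fam Z s"
    if "s \<in> S" "x \<in> carrier (amb (src f))" for s x
  proof -
    have "lin f x \<in> carrier (amb V)" using S_mor_closed[OF f.mor] that by simp
    then show ?thesis
      using assms that S_mor_fam[OF \<beta>_mor that(1), of "lin f x"]
      by (auto simp: S_iso_iff simp flip: commutes)
  qed
  then have "fam (ext_space S R f V) = fam (ext_space S R \<alpha> (ext_space S R g Z))"
    unfolding ext_space_def by (auto simp: fun_eq_iff \<alpha>_closed)
  then show ?thesis by (simp add: ext_space_def)
qed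

end

section \<open>Right minimality\<close>

context res_morphism
begin

text \<open>The right-hand side is the same as in \<open>hat_comp_eq_iff\<close>, so the equation f
  = f h passes between R-spaces and S-spaces.\<close>

lemma hom_comp_eq_iff:
  assumes h: "h \<in> S_hom K R (src f) (src f)"
  shows "f = S_comp f h \<longleftrightarrow> (\<forall>x\<in>carrier (amb (src f)). lin f x = lin f (lin h x))"
  using h by (subst eq_S_comp_iff[OF mor]) (auto simp: S_hom_def)

lemma hat_comp_eq_iff:
  assumes h: "h \<in> S_hom K S (ext_space S R f V) (ext_space S R f V)"
  shows "hat S R f V = S_comp (hat S R f V) h \<longleftrightarrow>
    (\<forall>x\<in>carrier (amb (src f)). lin f x = lin f (lin h x))"
  using h by (subst eq_S_comp_iff[OF S_mor_hat]) (auto simp: S_hom_def)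

text \<open>Reads f = f h as a commutative square with g = f and \<beta> the identity of V, so that
  h lifts to an endomorphism of U_f.\<close>

lemma endo_square:
  assumes h: "h \<in> S_hom K R (src f) (src f)" and e: "f = S_comp f h"
  shows "res_square K S R f V f V h (S_id V)"
proof -
  have "S_comp (res_mor R (S_id V)) f = S_comp f h"
    using S_comp_id(2)[OF mor] e tgt by (simp add: res_mor_def S_id_def S_comp_def res_def)
  then show ?thesis
    using h S_mor_id[OF S_space] res_morphism_axioms
    by (simp add: res_square_def res_square_axioms_def S_hom_def S_id_def)
qed

lemma res_hom:
  assumes "h \<in> S_hom K S (ext_space S R f V) (ext_space S R f V)"
  shows "res_mor R h \<in> S_hom K R (src f) (src f)"
  using assms S_mor_res[OF R_subset, of K h] by (simp add: S_hom_def res_mor_def res_ext)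

text \<open>
  On \<^term>\<open>S - R\<close> the condition for an endomorphism \<open>h\<close> with \<open>f = f h\<close> to be an isomorphism is
  automatic, because \<open>f x\<close> and \<open>f (h x)\<close> coincide.
\<close>

lemma endo_iso_iff:
  assumes h: "h \<in> S_hom K S (ext_space S R f V) (ext_space S R f V)"
    and e: "hat S R f V = S_comp (hat S R f V) h"
  shows "S_iso K S h \<longleftrightarrow> S_iso K R (res_mor R h)"
proof -
  have [simp]: "src h = ext_space S R f V" "tgt h = ext_space S R f V"
    using h by (auto simp: S_hom_def)
  have [simp]: "src (res_mor R h) = src f" "tgt (res_mor R h) = src f" "lin (res_mor R h) = lin h"
    by (simp_all add: res_mor_def res_ext)
  have mors: "S_mor K S h" "S_mor K R (res_mor R h)"
    using h res_hom[OF h] by (simp_all add: S_hom_def)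
  have "lin f x = lin f (lin h x)" if "x \<in> carrier (amb (src f))" for x
    using e that by (simp add: hat_comp_eq_iff[OF h])
  then have "(\<forall>s\<in>S. \<forall>x\<in>carrier (amb (src f)).
      lin h x \<in> fam (ext_space S R f V) s \<longrightarrow> x \<in> fam (ext_space S R f V) s) \<longleftrightarrow>
    (\<forall>s\<in>R. \<forall>x\<in>carrier (amb (src f)). lin h x \<in> fam (src f) s \<longrightarrow> x \<in> fam (src f) s)"
    using R_subset fam_ext_ideal fam_ext_outside
    by (smt (verit, best) mem_Collect_eq subsetD)
  then show ?thesis using mors by (simp add: S_iso_iff)
qed

text \<open>Lifting and restriction carry endomorphisms fixing f to endomorphisms fixing its
  extension and back without changing the linear map, and \<open>endo_iso_iff\<close> shows that
  being an isomorphism is unaffected.\<close>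

lemma right_minimal_hat_iff: "right_minimal K S (hat S R f V) \<longleftrightarrow> right_minimal K R f"
proof
  assume min: "right_minimal K S (hat S R f V)"
  have "S_iso K R h" if h: "h \<in> S_hom K R (src f) (src f)" and e: "f = S_comp f h" for h
  proof -
    interpret h: res_square K S R f V f V h "S_id V" by (rule endo_square[OF h e])
    have "hat S R f V = S_comp (hat S R f V) h.lift"
      using e hat_comp_eq_iff[OF h.lift_hom] hom_comp_eq_iff[OF h] by (simp add: h.lift_def)
    moreover from this have "S_iso K S h.lift"
      using min h.lift_hom by (simp add: right_minimal_def)
    ultimately show ?thesis using endo_iso_iff[OF h.lift_hom] h.res_lift by simp
  qed
  then show "right_minimal K R f" using mor by (simp add: right_minimal_def)
next
  assume min: "right_minimal K R f"
  have "S_iso K S h" if h: "h \<in> S_hom K S (ext_space S R f V) (ext_space S R f V)"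
    and e: "hat S R f V = S_comp (hat S R f V) h" for h
  proof -
    have "f = S_comp f (res_mor R h)"
      using e by (simp add: hat_comp_eq_iff[OF h] hom_comp_eq_iff[OF res_hom[OF h]])
        (simp add: res_mor_def)
    then have "S_iso K R (res_mor R h)"
      using min res_hom[OF h] by (simp add: right_minimal_def)
    then show ?thesis by (simp add: endo_iso_iff[OF h e])
  qed
  then show "right_minimal K S (hat S R f V)" using S_mor_hat by (simp add: right_minimal_def)
qed

end

section \<open>Right quasi fullness, vanishing outside a filter, and the theorem\<close>

lemma res_morphismI:
  assumes "order_ideal S R" "S_space K S V" "f \<in> S_hom K R U (res R V)"
  shows "res_morphism K S R f V"
  using assms by (simp add: res_morphism_def S_hom_def)

text \<open>The witnesses are U_f and Y_g with the two extended morphisms and \<open>lift\<close>.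
  The given objects u and y matter only through their restrictions, since f and g need not be
  morphisms on u and y themselves.\<close>

lemma right_quasi_full_res:
  assumes ideal: "order_ideal S R"
  shows "right_quasi_full (S_sp K S) (S_sp K R) (res_functor R)"
proof -
  have Hom: "Hom (S_sp K Q) U V = S_hom K Q U V" for Q :: "'a set" and U V
    by (auto simp: Hom_def S_sp_def S_hom_def)
  have simps: "Obj (S_sp K Q) = {V. S_space K Q V}" "Cmp (S_sp K Q) = S_comp" for Q :: "'a set"
    by (simp_all add: S_sp_def)
  have "\<exists>u'. S_space K S u' \<and> (\<exists>y'. S_space K S y' \<and>
      (\<exists>f'\<in>S_hom K S u' V. \<exists>g'\<in>S_hom K S y' Z. \<exists>\<alpha>'\<in>S_hom K S u' y'.
        f = res_mor R f' \<and> g = res_mor R g' \<and> \<alpha> = res_mor R \<alpha>' \<and> S_comp \<beta> f' = S_comp g' \<alpha>'))"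
    if VZ: "S_space K S V" "S_space K S Z" and \<beta>: "\<beta> \<in> S_hom K S V Z"
      and f: "f \<in> S_hom K R (res R U) (res R V)" and g: "g \<in> S_hom K R (res R Y) (res R Z)"
      and \<alpha>: "\<alpha> \<in> S_hom K R (res R U) (res R Y)"
      and sq: "S_comp (res_mor R \<beta>) f = S_comp g \<alpha>"
    for U V Y Z f g \<alpha> \<beta>
  proof -
    interpret res_square K S R f V g Z \<alpha> \<beta>
      using ideal VZ f g \<alpha> \<beta> sq
      by (auto simp: res_square_def res_square_axioms_def S_hom_def intro!: res_morphismI)
    have "hat S R f V \<in> S_hom K S (ext_space S R f V) V"
      "hat S R g Z \<in> S_hom K S (ext_space S R g Z) Z"
      by (simp_all add: S_hom_def f.S_mor_hat g.S_mor_hat)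
    then show ?thesis
      using f.S_space_ext g.S_space_ext f.res_hat g.res_hat lift_hom res_lift lift_commutes by metis
  qed
  moreover have "R \<subseteq> S" using ideal by (simp add: order_ideal_def)
  ultimately show ?thesis
    by (auto simp: right_quasi_full_def is_functor_res Hom simps) (simp_all add: res_functor_def)
qed

text \<open>The isomorphism embeds V(s) into the value of the induced space at s, which is
  zero.\<close>

lemma fam_outside_filter:
  assumes F: "order_filter S F" "S_isomorphic K S V (ind S F W)" "s \<in> S - F"
  shows "fam V s = {\<zero>\<^bsub>amb V\<^esub>}"
proof -
  let ?I = "ind S F W"
  obtain h where h: "S_mor K S h" "src h = V" "tgt h = ?I" "S_iso K S h"
    using F by (auto simp: S_isomorphic_def S_hom_def)
  have V: "S_space K S V" using h by (auto simp: S_mor_def)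
  then have z: "\<zero>\<^bsub>amb V\<^esub> \<in> fam V s"
    using F subspace_zero by (fastforce simp: S_space_def)
  have inj: "inj_on (lin h) (carrier (amb V))" using h by (simp add: S_iso_iff bij_betw_def)
  have sub: "fam V s \<subseteq> carrier (amb V)" using S_space_fam_carrier[OF V] F by simp
  have W: "vectorspace K (amb W)" using h by (auto simp: S_mor_def S_space_def ind_def)
  have const: "lin h x = \<zero>\<^bsub>amb W\<^esub>" if "x \<in> fam V s" for x
    using S_mor_fam[OF h(1), of s x] F that h ind_outside_filter[OF W, of S F s] by simp
  \<comment> \<open>Since the zero vector also lies in V(s), \<open>const\<close> applies to it as
    well, so x and zero have the same image.\<close>
  have "x = \<zero>\<^bsub>amb V\<^esub>" if "x \<in> fam V s" for x
    using inj_onD[OF inj, of x "\<zero>\<^bsub>amb V\<^esub>"] const that z sub by auto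
  then show ?thesis using z by blast
qed

text \<open>In (a) to (e) the spaces may have vectors of different types, whereas right quasi
  fullness concerns categories whose vectors share the single type \<open>'x\<close>; hence it forms
  a separate conjunct.\<close>

theorem proposition2p16:
  fixes K :: "('k, 'm) ring_scheme" and S R :: "'s::order set"
  assumes "field K" and "finite S" and "order_ideal S R"
  shows
   "(\<forall>(U :: ('k, 'u, 's) sspace) (V :: ('k, 'v, 's) sspace) f.
      S_space K R U \<and> S_space K S V \<and> f \<in> S_hom K R U (res R V) \<longrightarrow>

      \<comment> \<open>(a)\<close>
      S_space K S (ext_space S R f V) \<and>
      hat S R f V \<in> S_hom K S (ext_space S R f V) V \<and>
      f = res_mor R (hat S R f V) \<and>
      (proper_mor K R f \<longleftrightarrow> proper_mor K S (hat S R f V)) \<and>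
      (S_iso K R f \<longleftrightarrow> S_iso K S (hat S R f V)) \<and>

      \<comment> \<open>(b) and (c)\<close>
      (\<forall>(Y :: ('k, 'y, 's) sspace) (Z :: ('k, 'z, 's) sspace) g \<alpha> \<beta>.
         S_space K R Y \<and> S_space K S Z \<and>
         g \<in> S_hom K R Y (res R Z) \<and> \<alpha> \<in> S_hom K R U Y \<and> \<beta> \<in> S_hom K S V Z \<and>
         S_comp (res_mor R \<beta>) f = S_comp g \<alpha> \<longrightarrow>
         (let \<alpha>' = \<lparr>src = ext_space S R f V, tgt = ext_space S R g Z, lin = lin \<alpha>\<rparr> in
            \<alpha>' \<in> S_hom K S (ext_space S R f V) (ext_space S R g Z) \<and>
            \<alpha> = res_mor R \<alpha>' \<and>
            S_comp \<beta> (hat S R f V) = S_comp (hat S R g Z) \<alpha>' \<and>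
            (S_iso K S \<beta> \<longrightarrow>
               Y = res R (ext_space S R g Z) \<and>
               ext_space S R f V = ext_space S R \<alpha> (ext_space S R g Z) \<and>
               \<alpha>' = hat S R \<alpha> (ext_space S R g Z)))) \<and>

      \<comment> \<open>(d)\<close>
      (right_minimal K R f \<longleftrightarrow> right_minimal K S (hat S R f V)) \<and>

      \<comment> \<open>(e)\<close>
      (\<forall>F (W :: ('k, 'w, 's) sspace).
         order_filter S F \<and> S_space K F W \<and> S_isomorphic K S V (ind S F W) \<longrightarrow>
         (\<forall>s\<in>R - F. fam (ext_space S R f V) s \<subseteq> Ker f) \<and>
         (\<forall>s\<in>S - (R \<union> F). fam (ext_space S R f V) s = Ker f)))

    \<comment> \<open>the last assertion of (b)\<close>
    \<and> right_quasi_full (S_sp K S :: (('k, 'x, 's) sspace, _) category) (S_sp K R) (res_functor R)"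
proof (intro conjI allI impI)
  show "right_quasi_full (S_sp K S :: (('k, 'x, 's) sspace, _) category) (S_sp K R) (res_functor R)"
    by (rule right_quasi_full_res) (rule assms)
next
  fix U :: "('k, 'u, 's) sspace" and V :: "('k, 'v, 's) sspace" and f
  assume "S_space K R U \<and> S_space K S V \<and> f \<in> S_hom K R U (res R V)"
  then have V: "S_space K S V" and f: "f \<in> S_hom K R U (res R V)" by auto
  then have [simp]: "src f = U" by (simp add: S_hom_def)
  interpret f: res_morphism K S R f V using assms(3) V f by (rule res_morphismI)
  show "S_space K S (ext_space S R f V)" by (rule f.S_space_ext)
  show "hat S R f V \<in> S_hom K S (ext_space S R f V) V" by (simp add: S_hom_def f.S_mor_hat)
  show "f = res_mor R (hat S R f V)" by (simp add: f.res_hat)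
  show "proper_mor K R f \<longleftrightarrow> proper_mor K S (hat S R f V)" by (simp add: f.proper_hat_iff)
  show "S_iso K R f \<longleftrightarrow> S_iso K S (hat S R f V)" by (simp add: f.iso_hat_iff)
  show "right_minimal K R f \<longleftrightarrow> right_minimal K S (hat S R f V)"
    by (simp add: f.right_minimal_hat_iff)
  {
    fix Y :: "('k, 'y, 's) sspace" and Z :: "('k, 'z, 's) sspace" and g \<alpha> \<beta>
    assume sq: "S_space K R Y \<and> S_space K S Z \<and>
         g \<in> S_hom K R Y (res R Z) \<and> \<alpha> \<in> S_hom K R U Y \<and> \<beta> \<in> S_hom K S V Z \<and>
         S_comp (res_mor R \<beta>) f = S_comp g \<alpha>"
    then have [simp]: "src g = Y" by (simp add: S_hom_def)
    interpret res_square K S R f V g Z \<alpha> \<beta>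
      using sq f.res_morphism_axioms assms(3)
      by (auto simp: res_square_def res_square_axioms_def intro: res_morphismI)
    \<comment> \<open>The two records agree in target and linear map by definition, and their
      sources are U_f and U_\<alpha>.\<close>
    have "S_iso K S \<beta> \<Longrightarrow> lift = hat S R \<alpha> (ext_space S R g Z)"
      by (simp add: lift_def hat_def ext_eq_ext_\<alpha>)
    then show "let \<alpha>' = \<lparr>src = ext_space S R f V, tgt = ext_space S R g Z, lin = lin \<alpha>\<rparr> in
            \<alpha>' \<in> S_hom K S (ext_space S R f V) (ext_space S R g Z) \<and>
            \<alpha> = res_mor R \<alpha>' \<and>
            S_comp \<beta> (hat S R f V) = S_comp (hat S R g Z) \<alpha>' \<and>
            (S_iso K S \<beta> \<longrightarrow>
               Y = res R (ext_space S R g Z) \<and>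
               ext_space S R f V = ext_space S R \<alpha> (ext_space S R g Z) \<and>
               \<alpha>' = hat S R \<alpha> (ext_space S R g Z))"
      \<comment> \<open>The record bound to \<alpha>' in the statement is \<open>lift\<close>;
        folding it makes the facts about \<open>lift\<close> applicable.\<close>
      unfolding lift_def[symmetric] Let_def
      using lift_hom res_lift lift_commutes ext_eq_ext_\<alpha> g.res_ext by simp
  next
    fix F and W :: "('k, 'w, 's) sspace"
    assume "order_filter S F \<and> S_space K F W \<and> S_isomorphic K S V (ind S F W)"
    then have 0: "fam V s = {\<zero>\<^bsub>amb V\<^esub>}" if "s \<in> S - F" for s
      using fam_outside_filter that by blast
    show "\<forall>s\<in>R - F. fam (ext_space S R f V) s \<subseteq> Ker f"
      using 0 f.fam_ext_subset_Ker f.R_subset by blast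
    show "\<forall>s\<in>S - (R \<union> F). fam (ext_space S R f V) s = Ker f"
      using 0 f.fam_ext_eq_Ker by blast
  }
qed

end
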